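(* Let $R$ be a commutative ring with identity, let $G=(V,E)$ be a connected graph, and fix an ordering $v_1,\dots,v_{|V|}$ of $V$ such that for every $1<i\le|V|$ the vertex $v_i$ is adjacent to at least one of $v_1,\dots,v_{i-1}$. Let $I=\langle\mathsf{i}\rangle$ be a principal ideal of $R$ and let $\alpha$ be the constant edge-labeling $\alpha(e)=I$ for all $e\in E$. For $v\in V$ let $\mathbf{I}^v$ be the indicator spline of $I$ at $v$, that is, the spline with $\mathbf{I}^v_v=\mathsf{i}$ and $\mathbf{I}^v_u=0$ for all $u\neq v$. Then the set $\mathcal{B}=\{\mathbf{1},\mathbf{I}^{v_2},\dots,\mathbf{I}^{v_{|V|}}\}$ is a minimum generating set for $R_{G,\alpha}$. Moreover, if $R$ is an integral domain, then $R_{G,\alpha}$ is a free $R$-module with basis $\mathcal{B}$.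
   Context: Graphs are finite, with at most one edge between any two distinct vertices and no loops. An edge-labeling of $G=(V,E)$ is a function $\alpha$ from $E$ to the set of ideals of $R$. A (generalized) spline on $(G,\alpha)$ is a vector $\mathbf{p}\in\bigoplus_{v\in V}R$ with $\mathbf{p}_u-\mathbf{p}_v\in\alpha(uv)$ for every edge $uv\in E$. The set $R_{G,\alpha}$ of splines is an $R$-module under coordinatewise operations. The trivial spline $\mathbf{1}$ has $\mathbf{1}_v=1$ for all $v$. A minimum generating set (MGS) for $R_{G,\alpha}$ is a set of splines generating $R_{G,\alpha}$ as an $R$-module such that no other generating set has fewer elements.
   Formalization: The ring R is assumed nonzero, and the generator of I is assumed nonzero when G has more than one vertex; in the excluded cases the claim is false (the empty set, respectively the trivial spline alone, generates, so B is not minimum). *)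

theory Defs
  imports Complex_Main "HOL-Library.Function_Algebras" "HOL-Library.Equipollence"
begin

definition simple_graph :: "'v set \<Rightarrow> 'v set set \<Rightarrow> bool" where
  "simple_graph V E \<longleftrightarrow> finite V \<and> (\<forall>e\<in>E. e \<subseteq> V \<and> card e = 2)"

definition connected_graph :: "'v set \<Rightarrow> 'v set set \<Rightarrow> bool" where
  "connected_graph V E \<longleftrightarrow>
     V \<noteq> {} \<and> (\<forall>u\<in>V. \<forall>w\<in>V. (u, w) \<in> {(x, y). {x, y} \<in> E}\<^sup>*)"

text \<open>Ideals are the submodules of the ring over itself. The locale is not interpreted for \<open>(*)\<close>,
  because its simplification rule \<open>scale_scale\<close> would then loop with \<open>mult.assoc\<close>.
  Note that the class \<open>comm_ring_1\<close> excludes the zero ring.\<close>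

definition is_ideal :: "'a::comm_ring_1 set \<Rightarrow> bool" where
  "is_ideal J \<longleftrightarrow> module.subspace (*) J"

definition ideal_generated :: "'a::comm_ring_1 set \<Rightarrow> 'a set" where
  "ideal_generated X = module.span (*) X"

lemma module_mult: "module ((*) :: 'a::comm_ring_1 \<Rightarrow> 'a \<Rightarrow> 'a)"
  by unfold_locales (simp_all add: algebra_simps)

definition vscale :: "'a::comm_ring_1 \<Rightarrow> ('v \<Rightarrow> 'a) \<Rightarrow> 'v \<Rightarrow> 'a" where
  "vscale r p = (\<lambda>v. r * p v)"

interpretation vmod: module "vscale :: 'a::comm_ring_1 \<Rightarrow> ('v \<Rightarrow> 'a) \<Rightarrow> 'v \<Rightarrow> 'a"
  by unfold_locales (simp_all add: vscale_def fun_eq_iff algebra_simps)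

definition edge_labeling :: "'v set set \<Rightarrow> ('v set \<Rightarrow> 'a::comm_ring_1 set) \<Rightarrow> bool" where
  "edge_labeling E \<alpha> \<longleftrightarrow> (\<forall>e\<in>E. is_ideal (\<alpha> e))"

text \<open>Vectors indexed by \<open>V\<close> are functions on the whole type that vanish outside \<open>V\<close>.\<close>

definition splines ::
    "'v set \<Rightarrow> 'v set set \<Rightarrow> ('v set \<Rightarrow> 'a::comm_ring_1 set) \<Rightarrow> ('v \<Rightarrow> 'a) set" where
  "splines V E \<alpha> =
     {p. (\<forall>v. v \<notin> V \<longrightarrow> p v = 0) \<and> (\<forall>u w. {u, w} \<in> E \<longrightarrow> p u - p w \<in> \<alpha> {u, w})}"

lemma subspace_splines: "edge_labeling E \<alpha> \<Longrightarrow> vmod.subspace (splines V E \<alpha>)"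
  unfolding vmod.subspace_def splines_def edge_labeling_def is_ideal_def
    module.subspace_def[OF module_mult] vscale_def
  by (auto simp: add_diff_add simp flip: right_diff_distrib)

definition trivial_spline :: "'v set \<Rightarrow> 'v \<Rightarrow> 'a::comm_ring_1" where
  "trivial_spline V = (\<lambda>v. if v \<in> V then 1 else 0)"

definition indicator_spline :: "'a::comm_ring_1 \<Rightarrow> 'v \<Rightarrow> 'v \<Rightarrow> 'a" where
  "indicator_spline i v = (\<lambda>u. if u = v then i else 0)"

definition generating_set :: "('v \<Rightarrow> 'a::comm_ring_1) set \<Rightarrow> ('v \<Rightarrow> 'a) set \<Rightarrow> bool" where
  "generating_set M S \<longleftrightarrow> S \<subseteq> M \<and> vmod.span S = M"

text \<open>\<open>T \<prec> S\<close> says that \<open>T\<close> has strictly smaller cardinality than \<open>S\<close>, also for infinite sets.\<close>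

definition minimum_generating_set ::
    "('v \<Rightarrow> 'a::comm_ring_1) set \<Rightarrow> ('v \<Rightarrow> 'a) set \<Rightarrow> bool" where
  "minimum_generating_set M S \<longleftrightarrow>
     generating_set M S \<and> (\<forall>T. generating_set M T \<longrightarrow> \<not> T \<prec> S)"

definition free_with_basis :: "('v \<Rightarrow> 'a::comm_ring_1) set \<Rightarrow> ('v \<Rightarrow> 'a) set \<Rightarrow> bool" where
  "free_with_basis M S \<longleftrightarrow> generating_set M S \<and> vmod.independent S"

end

theory Submission
  imports Defs "Jordan_Normal_Form.Determinant"
begin

text \<open>Since \<open>G\<close> is connected, all entries of a spline are congruent modulo \<open>I\<close>; subtracting
  the multiple of the trivial spline that clears one entry leaves a combination of the indicators,
  so \<open>B\<close> generates. For minimality, write \<open>B\<close> in terms of a generating set \<open>T\<close> and \<open>T\<close> in terms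
  of \<open>B\<close>. The coefficients along the indicators are determined only modulo the annihilator of \<open>i\<close>,
  so the product of the two coefficient matrices need not be the identity, but it is so after
  multiplication by \<open>i\<close>. If \<open>T\<close> were smaller than \<open>B\<close>, this product would have determinant \<open>0\<close>,
  whence \<open>i = i * 1 = 0\<close>.\<close>

section \<open>Products and determinants up to a fixed ring multiple\<close>

text \<open>The factor \<open>c\<close> cannot be cancelled, but a single copy of it suffices: it
  moves from factor to factor and allows them to be exchanged one at a time.\<close>

lemma mult_prod_cong:
  fixes c :: "'a::comm_monoid_mult"
  assumes "\<And>x. x \<in> S \<Longrightarrow> c * f x = c * g x"
  shows "c * prod f S = c * prod g S"
  using assms
proof (induction S rule: infinite_finite_induct)
  case (insert x S)
  have fg: "c * f x = c * g x"
    using insert.prems by blast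
  have "c * prod f (insert x S) = (c * f x) * prod f S"
    using insert.hyps by (simp add: mult.assoc)
  also have "\<dots> = g x * (c * prod f S)"
    unfolding fg by (simp add: mult_ac)
  also have "c * prod f S = c * prod g S"
    using insert by blast
  also have "g x * \<dots> = c * prod g (insert x S)"
    using insert.hyps by (simp add: mult_ac)
  finally show ?case .
qed auto

text \<open>Each Leibniz term is a signed product of entries, so the exchange of factors applies
  term by term.\<close>

lemma mult_det_cong:
  fixes c :: "'a::comm_ring_1"
  assumes A: "A \<in> carrier_mat n n" and B: "B \<in> carrier_mat n n"
    and eq: "\<And>j k. j < n \<Longrightarrow> k < n \<Longrightarrow> c * A $$ (j, k) = c * B $$ (j, k)"
  shows "c * det A = c * det B"
proof -
  have "c * (\<Prod>j = 0..<n. A $$ (j, \<pi> j)) = c * (\<Prod>j = 0..<n. B $$ (j, \<pi> j))"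
    if "\<pi> permutes {0..<n}" for \<pi>
    using permutes_in_image[OF that] by (intro mult_prod_cong eq) auto
  then show ?thesis
    unfolding det_def'[OF A] det_def'[OF B] sum_distrib_left
    by (intro sum.cong refl) (simp add: mult.left_commute[of c])
qed

text \<open>Every Leibniz term has a factor from row \<open>m\<close>.\<close>

lemma det_zero_row:
  assumes A: "A \<in> carrier_mat n n" and m: "m < n" and zero: "\<And>k. k < n \<Longrightarrow> A $$ (m, k) = 0"
  shows "det A = 0"
proof -
  have "(\<Prod>j = 0..<n. A $$ (j, \<pi> j)) = 0" if "\<pi> permutes {0..<n}" for \<pi>
    using permutes_in_image[OF that, of m] m zero by (intro prod_zero bexI[of _ m]) auto
  then show ?thesis
    unfolding det_def'[OF A] by simp
qed

text \<open>Replaces the dimension count for vector spaces: over any commutative ring,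
  \<open>c\<close> times the identity of size \<open>card A\<close> cannot factor through the
  smaller index set \<open>T\<close> unless \<open>c\<close> vanishes.\<close>

lemma factor_scaled_identity_imp_zero:
  fixes c :: "'a::comm_ring_1" and P :: "'b \<Rightarrow> 'c \<Rightarrow> 'a" and Q :: "'c \<Rightarrow> 'b \<Rightarrow> 'a"
  assumes finA: "finite A" and finT: "finite T" and less: "card T < card A"
    and eq: "\<And>a b. a \<in> A \<Longrightarrow> b \<in> A \<Longrightarrow> c * (\<Sum>t\<in>T. P a t * Q t b) = (if a = b then c else 0)"
  shows "c = 0"
proof -
  define n m where "n = card A" and "m = card T"
  obtain f where f: "bij_betw f {0..<n} A"
    using ex_bij_betw_nat_finite[OF finA] n_def by blast
  obtain g where g: "bij_betw g {0..<m} T"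
    using ex_bij_betw_nat_finite[OF finT] m_def by blast
  have mn: "m < n"
    using less by (simp add: n_def m_def)
  \<comment> \<open>Zero columns of \<open>M\<close> and zero rows of \<open>N\<close> pad both
    matrices to size \<open>n\<close>, so that the determinant is multiplicative on them; the
    product is unchanged.\<close>
  define M where "M = mat n n (\<lambda>(l, j). if j < m then P (f l) (g j) else 0)"
  define N where "N = mat n n (\<lambda>(j, k). if j < m then Q (g j) (f k) else 0)"
  have M: "M \<in> carrier_mat n n" and N: "N \<in> carrier_mat n n"
    by (auto simp: M_def N_def)
  have entry: "(M * N) $$ (l, k) = (\<Sum>t\<in>T. P (f l) t * Q t (f k))" if "l < n" "k < n" for l k
  proof -
    have "(M * N) $$ (l, k) = (\<Sum>j = 0..<n. M $$ (l, j) * N $$ (j, k))"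
      using that M N by (auto simp: scalar_prod_def)
    also have "\<dots> = (\<Sum>j = 0..<m. P (f l) (g j) * Q (g j) (f k))"
      using that mn by (intro sum.mono_neutral_cong_right) (auto simp: M_def N_def)
    also have "\<dots> = (\<Sum>t\<in>T. P (f l) t * Q t (f k))"
      by (rule sum.reindex_bij_betw[OF g])
    finally show ?thesis .
  qed
  have "c * det (M * N) = c * det (1\<^sub>m n)"
  proof (rule mult_det_cong)
    fix j k assume "j < n" "k < n"
    then show "c * (M * N) $$ (j, k) = c * 1\<^sub>m n $$ (j, k)"
      using f eq[of "f j" "f k"] by (auto simp: entry bij_betw_def inj_on_eq_iff)
  qed (use M N in auto)
  \<comment> \<open>Row \<open>m\<close> is the first padding row; it exists because
    \<open>m < n\<close>.\<close>
  moreover have "det N = 0"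
    using mn by (intro det_zero_row[OF N mn]) (simp add: N_def)
  ultimately show ?thesis
    by (simp add: det_mult[OF M N])
qed

section \<open>Splines for a constant principal label\<close>

lemma sum_fun_apply: "(\<Sum>x\<in>S. f x) y = (\<Sum>x\<in>S. f x y)"
  for f :: "'b \<Rightarrow> 'c \<Rightarrow> 'a::comm_monoid_add"
  by (induction S rule: infinite_finite_induct) auto

lemma mem_ideal_generated_singleton: "x \<in> ideal_generated {i} \<longleftrightarrow> (\<exists>c. x = c * i)"
  unfolding ideal_generated_def module.span_singleton[OF module_mult] by auto

text \<open>Differences along a path from \<open>u\<close> to \<open>w\<close> telescope, and each
  edge contributes a multiple of \<open>i\<close>.\<close>

lemma spline_diff_mem_ideal:
  fixes \<alpha> :: "'v set \<Rightarrow> 'a::comm_ring_1 set"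
  assumes conn: "connected_graph V E" and lab: "\<And>e. e \<in> E \<Longrightarrow> \<alpha> e = ideal_generated {i}"
    and p: "p \<in> splines V E \<alpha>" and u: "u \<in> V" and w: "w \<in> V"
  shows "\<exists>c. p w - p u = c * i"
proof -
  have "(u, w) \<in> {(x, y). {x, y} \<in> E}\<^sup>*"
    using conn u w by (auto simp: connected_graph_def)
  then show ?thesis
  proof induction
    case base
    show ?case by (intro exI[of _ 0]) simp
  next
    case (step y z)
    then have "p y - p z \<in> ideal_generated {i}"
      using p lab by (auto simp: splines_def)
    then obtain d where d: "p y - p z = d * i"
      by (auto simp: mem_ideal_generated_singleton)
    obtain c where c: "p y - p u = c * i"
      using step.IH by blast
    have "p z - p u = (p y - p u) - (p y - p z)"
      by simp
    also have "\<dots> = (c - d) * i"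
      unfolding c d by (simp add: left_diff_distrib)
    finally show ?case by blast
  qed
qed

lemma combination_apply:
  fixes i :: "'a::comm_ring_1"
  assumes "finite V" and "r \<in> V" and "x \<in> V"
  shows "(vscale a (trivial_spline V) + (\<Sum>w\<in>V - {r}. vscale (c w) (indicator_spline i w))) x =
         a + (if x = r then 0 else c x * i)"
proof -
  have "(\<Sum>w\<in>V - {r}. c w * (if x = w then i else 0)) = (if x = r then 0 else c x * i)"
    \<comment> \<open>Only the indicator at \<open>x\<close> can contribute; the support
      \<open>{x} - {r}\<close> is empty at the root.\<close>
    using assms by (subst sum.mono_neutral_cong_right[where S = "{x} - {r}" and h = "\<lambda>w. c w * i"])
      auto
  then show ?thesis
    using assms by (simp add: sum_fun_apply vscale_def trivial_spline_def indicator_spline_def)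
qed

text \<open>The root \<open>r\<close> stands for the first vertex of the ordering. Being a set, it
  merges indicators that coincide.\<close>

definition constant_label_basis :: "'v set \<Rightarrow> 'v \<Rightarrow> 'a::comm_ring_1 \<Rightarrow> ('v \<Rightarrow> 'a) set" where
  "constant_label_basis V r i = insert (trivial_spline V) (indicator_spline i ` (V - {r}))"

lemma constant_label_basis_subset_splines:
  fixes i :: "'a::comm_ring_1"
  assumes graph: "simple_graph V E" and lab: "\<And>e. e \<in> E \<Longrightarrow> \<alpha> e = ideal_generated {i}"
  shows "constant_label_basis V r i \<subseteq> splines V E \<alpha>"
proof -
  have multiple: "c * i \<in> ideal_generated {i}" for c
    by (auto simp: mem_ideal_generated_singleton)
  have zero: "0 \<in> ideal_generated {i}" and gen: "i \<in> ideal_generated {i}"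
    and neg: "- i \<in> ideal_generated {i}"
    using multiple[of 0] multiple[of 1] multiple[of "-1"] by auto
  \<comment> \<open>With both ends of an edge in \<open>V\<close>, the trivial spline has difference
    0 there; an indicator has difference 0, \<open>i\<close> or \<open>- i\<close>.\<close>
  have "u \<in> V \<and> w \<in> V" if "{u, w} \<in> E" for u w
    using that graph by (auto simp: simple_graph_def)
  then show ?thesis
    using zero gen neg lab
    by (auto simp: constant_label_basis_def splines_def trivial_spline_def indicator_spline_def)
qed

lemma generating_set_constant_label_basis:
  fixes i :: "'a::comm_ring_1"
  assumes graph: "simple_graph V E" and conn: "connected_graph V E" and r: "r \<in> V"
    and edge: "edge_labeling E \<alpha>" and lab: "\<And>e. e \<in> E \<Longrightarrow> \<alpha> e = ideal_generated {i}"
  shows "generating_set (splines V E \<alpha>) (constant_label_basis V r i)"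
    (is "generating_set ?M ?B")
proof -
  have finV: "finite V"
    using graph by (simp add: simple_graph_def)
  have sub: "?B \<subseteq> ?M"
    using graph lab by (rule constant_label_basis_subset_splines)
  have "p \<in> vmod.span ?B" if p: "p \<in> ?M" for p
  proof -
    have "\<exists>c. p w - p r = c * i" if "w \<in> V" for w
      by (rule spline_diff_mem_ideal[OF conn lab p r that])
    then obtain c where c: "\<And>w. w \<in> V \<Longrightarrow> p w - p r = c w * i"
      by metis
    \<comment> \<open>The coefficient of the trivial spline is read off at the root, the others from
      the differences to the root.\<close>
    let ?q = "vscale (p r) (trivial_spline V) + (\<Sum>w\<in>V - {r}. vscale (c w) (indicator_spline i w))"
    have "p x = ?q x" for x
    proof (cases "x \<in> V")
      case True
      then show ?thesis
        unfolding combination_apply[OF finV r True] by (auto simp: c[symmetric])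
    next
      case False
      then have "p x = 0"
        using p by (auto simp: splines_def)
      moreover have "(\<Sum>w\<in>V - {r}. vscale (c w) (indicator_spline i w) x) = 0"
        using False by (intro sum.neutral) (auto simp: vscale_def indicator_spline_def)
      ultimately show ?thesis
        using False by (simp add: sum_fun_apply vscale_def trivial_spline_def)
    qed
    then have "p = ?q" ..
    moreover have "?q \<in> vmod.span ?B"
      by (intro vmod.span_add vmod.span_sum vmod.span_scale vmod.span_base)
        (auto simp: constant_label_basis_def)
    ultimately show ?thesis by simp
  qed
  moreover have "vmod.span ?B \<subseteq> ?M"
    using sub subspace_splines[OF edge] by (rule vmod.span_minimal)
  ultimately show ?thesis
    using sub unfolding generating_set_def by blast
qed

text \<open>The condition on \<open>i\<close> excludes a genuine exception: if \<open>i = 0\<close>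
  and there are several vertices, all splines are constant and the trivial spline alone
  generates.\<close>

lemma not_lesspoll_constant_label_basis:
  fixes V :: "'v set" and i :: "'a::comm_ring_1"
  assumes graph: "simple_graph V E" and conn: "connected_graph V E" and r: "r \<in> V"
    and lab: "\<And>e. e \<in> E \<Longrightarrow> \<alpha> e = ideal_generated {i}"
    and nonzero: "1 < card V \<Longrightarrow> i \<noteq> 0"
    and T: "generating_set (splines V E \<alpha>) T"
  shows "\<not> T \<prec> constant_label_basis V r i"
proof
  let ?B = "constant_label_basis V r i"
  assume less: "T \<prec> ?B"
  have finV: "finite V"
    using graph by (simp add: simple_graph_def)
  have finB: "finite ?B"
    by (simp add: constant_label_basis_def finV)
  \<comment> \<open>An upper bound for the size of \<open>?B\<close> suffices: a set smaller than
    \<open>?B\<close> is then smaller than \<open>V\<close>.\<close>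
  have "card (indicator_spline i ` (V - {r})) \<le> card (V - {r})"
    by (rule card_image_le) (simp add: finV)
  then have "card ?B \<le> Suc (card (V - {r}))"
    unfolding constant_label_basis_def by (simp add: card_insert_if finV)
  also have "\<dots> = card V"
    using card_Suc_Diff1[OF finV r] by simp
  finally have cardB: "card ?B \<le> card V" .
  have "?B \<approx> {..<card ?B}"
    using finB by (simp add: eqpoll_iff_finite_card)
  with less have "T \<prec> {..<card ?B}"
    by (rule lesspoll_eq_trans)
  then have finT: "finite T" and "card T < card ?B"
    by (simp_all add: lesspoll_iff_finite_card)
  with cardB have cardT: "card T < card V"
    by simp
  have "?B \<subseteq> splines V E \<alpha>"
    using graph lab by (rule constant_label_basis_subset_splines)
  then have sub: "?B \<subseteq> vmod.span T" and TM: "T \<subseteq> splines V E \<alpha>"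
    using T by (auto simp: generating_set_def)
  show False
  proof (cases "card V = 1")
    case True
    then have "T = {}"
      using cardT finT by simp
    \<comment> \<open>The empty set spans only 0, whereas the trivial spline takes the value 1 at
      \<open>r\<close>.\<close>
    then have "trivial_spline V = (0 :: 'v \<Rightarrow> 'a)"
      using sub by (auto simp: constant_label_basis_def)
    then show False
      using r by (auto simp: trivial_spline_def fun_eq_iff split: if_splits)
  next
    case False
    then have i: "i \<noteq> 0"
      using nonzero cardT card_gt_0_iff[of V] finV r by fastforce
    \<comment> \<open>Indexing the generators by vertices makes \<open>V\<close> the index set of
      the matrix product.\<close>
    define b :: "'v \<Rightarrow> 'v \<Rightarrow> 'a"
      where "b = (\<lambda>x. if x = r then trivial_spline V else indicator_spline i x)"
    have "\<exists>u. b x = (\<Sum>t\<in>T. vscale (u t) t)" if "x \<in> V" for x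
    proof -
      have "b x \<in> vmod.span T"
        using sub that by (auto simp: b_def constant_label_basis_def)
      then show ?thesis
        by (auto simp: vmod.span_finite[OF finT])
    qed
    then obtain P where P: "\<And>x. x \<in> V \<Longrightarrow> b x = (\<Sum>t\<in>T. vscale (P x t) t)"
      by metis
    have "\<exists>c. t y - t r = c * i" if "t \<in> T" "y \<in> V" for t y
      by (rule spline_diff_mem_ideal[OF conn lab _ r that(2)]) (use TM that in auto)
    then obtain C where C: "\<And>t y. t \<in> T \<Longrightarrow> y \<in> V \<Longrightarrow> t y - t r = C t y * i"
      by metis
    have val: "b x y = (\<Sum>t\<in>T. P x t * t y)" if "x \<in> V" for x y
      using P[OF that] by (simp add: sum_fun_apply vscale_def)
    have "i = 0"
    proof (rule factor_scaled_identity_imp_zero[OF finV finT cardT])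
      fix x y assume x: "x \<in> V" and y: "y \<in> V"
      \<comment> \<open>A coefficient of \<open>t\<close> along \<open>b y\<close>: its value at the
        root for the trivial spline, otherwise the chosen quotient \<open>C t y\<close>.\<close>
      let ?Q = "\<lambda>t y. if y = r then t r else C t y"
      show "i * (\<Sum>t\<in>T. P x t * ?Q t y) = (if x = y then i else 0)"
      proof (cases "y = r")
        case True
        then show ?thesis
          using r val[OF x, of r] by (auto simp: b_def trivial_spline_def indicator_spline_def)
      next
        case False
        \<comment> \<open>Multiplication by \<open>i\<close> turns the chosen quotient back into the
          actual difference \<open>t y - t r\<close>, so the choice no longer matters.\<close>
        have "i * (\<Sum>t\<in>T. P x t * ?Q t y) = (\<Sum>t\<in>T. P x t * (C t y * i))"
          using False by (simp add: sum_distrib_left mult_ac)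
        also have "\<dots> = (\<Sum>t\<in>T. P x t * (t y - t r))"
          using C y by (intro sum.cong) auto
        also have "\<dots> = b x y - b x r"
          using val[OF x] by (simp add: sum_subtractf right_diff_distrib)
        also have "\<dots> = (if x = y then i else 0)"
          using False r y by (auto simp: b_def trivial_spline_def indicator_spline_def)
        finally show ?thesis .
      qed
    qed
    with i show False
      by simp
  qed
qed

text \<open>Evaluating a vanishing combination at \<open>r\<close> kills the coefficient of the
  trivial spline; evaluating at any other vertex then leaves a coefficient times \<open>i\<close>,
  and \<open>i\<close> can be cancelled in a domain.\<close>

lemma independent_constant_label_basis:
  fixes V :: "'v set" and i :: "'a::comm_ring_1"
  assumes finV: "finite V" and r: "r \<in> V"
    and nonzero: "1 < card V \<Longrightarrow> i \<noteq> 0"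
    and dom: "\<And>a b :: 'a. a * b = 0 \<Longrightarrow> a = 0 \<or> b = 0"
  shows "vmod.independent (constant_label_basis V r i)"
proof -
  have i: "i \<noteq> 0" if "w \<in> V - {r}" for w
  proof -
    have "card {r, w} \<le> card V"
      using that r finV by (intro card_mono) auto
    then show ?thesis
      using that nonzero by auto
  qed
  let ?t = "trivial_spline V :: 'v \<Rightarrow> 'a"
  have inj: "inj_on (indicator_spline i) (V - {r})"
  proof (rule inj_onI)
    fix w x assume w: "w \<in> V - {r}" and "indicator_spline i w = indicator_spline i x"
    then have "indicator_spline i w w = indicator_spline i x w"
      by simp
    then show "w = x"
      using i[OF w] by (simp add: indicator_spline_def split: if_splits)
  qed
  have "?t r \<noteq> indicator_spline i w r" if "w \<in> V - {r}" for w
    using that r by (auto simp: trivial_spline_def indicator_spline_def)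
  then have notin: "?t \<notin> indicator_spline i ` (V - {r})"
    by fastforce
  have "\<forall>b\<in>constant_label_basis V r i. u b = 0"
    if comb: "(\<Sum>b\<in>constant_label_basis V r i. vscale (u b) b) = 0" for u
  proof -
    let ?c = "\<lambda>w. u (indicator_spline i w)"
    \<comment> \<open>Since the generators are pairwise distinct, the sum over the set becomes a sum
      over vertices.\<close>
    have "vscale (u ?t) ?t + (\<Sum>w\<in>V - {r}. vscale (?c w) (indicator_spline i w)) = 0"
      using comb notin finV by (simp add: constant_label_basis_def sum.reindex[OF inj])
    then have eval: "u ?t + (if x = r then 0 else ?c x * i) = 0" if "x \<in> V" for x
      using combination_apply[OF finV r that, of "u ?t" ?c i] by simp
    have "u ?t = 0"
      using eval[OF r] by simp
    moreover have "?c w = 0" if "w \<in> V - {r}" for w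
      using eval[of w] that \<open>u ?t = 0\<close> dom[of "?c w" i] i[OF that] by auto
    ultimately show ?thesis
      by (auto simp: constant_label_basis_def)
  qed
  then show ?thesis
    by (subst vmod.dependent_finite) (auto simp: constant_label_basis_def finV)
qed

theorem theorem3p1:
  fixes V :: "'v set" and E :: "'v set set"
    and v :: "nat \<Rightarrow> 'v"
    and i :: "'a::comm_ring_1" and I :: "'a set"
    and \<alpha> :: "'v set \<Rightarrow> 'a set"
    and B :: "('v \<Rightarrow> 'a) set"
  assumes "simple_graph V E" and "connected_graph V E"
    and "bij_betw v {1..card V} V"
    and "\<And>k. 1 < k \<Longrightarrow> k \<le> card V \<Longrightarrow> \<exists>j\<in>{1..<k}. {v j, v k} \<in> E"
    and "I = ideal_generated {i}"
    and "edge_labeling E \<alpha>" and "\<And>e. e \<in> E \<Longrightarrow> \<alpha> e = I"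
    and nonzero: "1 < card V \<Longrightarrow> i \<noteq> 0"
    and "B = insert (trivial_spline V) ((\<lambda>k. indicator_spline i (v k)) ` {2..card V})"
  shows "minimum_generating_set (splines V E \<alpha>) B \<and>
         ((\<forall>a b :: 'a. a * b = 0 \<longrightarrow> a = 0 \<or> b = 0) \<longrightarrow> free_with_basis (splines V E \<alpha>) B)"
proof -
  have finV: "finite V" and "V \<noteq> {}"
    using assms(1,2) by (auto simp: simple_graph_def connected_graph_def)
  then have card: "1 \<le> card V"
    by (simp add: Suc_le_eq card_gt_0_iff)
  then have r: "v 1 \<in> V"
    using assms(3) by (auto simp: bij_betw_def)
  \<comment> \<open>By injectivity of \<open>v\<close>, dropping the index 1 drops exactly the root
    \<open>v 1\<close>.\<close>
  have "{2..card V} = {1..card V} - {1}"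
    by auto
  then have "v ` {2..card V} = V - {v 1}"
    using assms(3) card by (simp add: bij_betw_def inj_on_image_set_diff[of v "{1..card V}"])
  then have B: "B = constant_label_basis V (v 1) i"
    unfolding assms(9) constant_label_basis_def by (metis image_image)
  have lab: "\<And>e. e \<in> E \<Longrightarrow> \<alpha> e = ideal_generated {i}"
    using assms(5,7) by simp
  have gen: "generating_set (splines V E \<alpha>) B"
    unfolding B using assms(1,2) r assms(6) lab by (rule generating_set_constant_label_basis)
  moreover have "\<not> T \<prec> B" if "generating_set (splines V E \<alpha>) T" for T
    unfolding B using assms(1,2) r lab nonzero that by (rule not_lesspoll_constant_label_basis)
  moreover have "vmod.independent B" if "\<forall>a b :: 'a. a * b = 0 \<longrightarrow> a = 0 \<or> b = 0"
    unfolding B using that by (intro independent_constant_label_basis finV r nonzero) auto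
  ultimately show ?thesis
    by (auto simp: minimum_generating_set_def free_with_basis_def)
qed

end
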